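(* Consider the imuQP algorithm applied to the quadratic program $\min_{\theta}\frac12\theta^TE\theta+\theta^TF$ subject to $M\theta\le\gamma$, with $E\succ0$. Suppose that at iteration $m$ the current active set is $\mathbb A^m_{\rm old}$, with $M_{\mathbb A^m_{\rm old}}$ of full row rank, and that for the to-be-added $j$-th constraint the quantities $y=H_{\rm old}^{-1}\mathbf h$ and $q=h-\mathbf h^Ty$ computed in step 4.b satisfy $q=0$ and $y_{\max}=\max(y)\le0$. Then the quadratic program is infeasible, i.e. $\{\theta\mid M\theta\le\gamma\}=\varnothing$.
   Context: Data: $E\in\mathbb R^{d\times d}$ symmetric, $E\succ0$; $F\in\mathbb R^{d}$; $M\in\mathbb R^{p\times d}$ with rows $m_1,\dots,m_p$; $\gamma\in\mathbb R^p$; $H=ME^{-1}M^T$ with entries $h_{ij}$ (here $d=Nn_u$). Inequalities between vectors are componentwise. The $n$-th constraint is $m_n\theta\le\gamma_n$. The active set $\mathbb A$ is an ordered list of $c=|\mathbb A|$ distinct constraint indices. $M_{\mathbb A}$ consists of the rows $m_n$, $n\in\mathbb A$; $H_{\mathbb A}=M_{\mathbb A}E^{-1}M_{\mathbb A}^T$ is the submatrix of $H$ with rows and columns in $\mathbb A$; $H_{\mathbb A,\rm col}$ consists of the columns of $H$ indexed by $\mathbb A$; $K_{\mathbb A}$ consists of the entries of $K_0=\gamma-M\theta_0$ indexed by $\mathbb A$. For every active set, $\lambda_{\mathbb A}=-H_{\mathbb A}^{-1}K_{\mathbb A}\in\mathbb R^c$. The additive and subtractive inverse matrix updates (AIMU,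 SIMU) are exact formulas producing $H_{\mathbb A}^{-1}$ and $\lambda_{\mathbb A}=-H_{\mathbb A}^{-1}K_{\mathbb A}$ for the new active set when one index is appended to, respectively removed from, the list. Exact arithmetic is used; $\arg\min$, $\arg\max$ denote an index attaining the extremum. imuQP algorithm. 1. $\theta_0=-E^{-1}F$. 2. $K_0=\gamma-M\theta_0$. 3. Set iteration counter $m=1$, $K_{\min}=\min(K_0)$, $j=\arg\min(K_0)$, $\mathbb A=\varnothing$, $c=0$. If $K_{\min}\ge0$, set $\theta^*=\theta_0$ and return. 4. While $K_{\min}<0$: a. If $j\in\mathbb A$, break (exit loop 4). Otherwise $m\leftarrow m+1$, $c\leftarrow c+1$, append $j$ to the end of $\mathbb A$. b. If $c=1$: $H_{\mathbb A}^{-1}=1/h_{jj}$, $\lambda_{\mathbb A}=-H_{\mathbb A}^{-1}K_{\min}$. Otherwise, let $H_{\rm old}=H_{\mathbb A_{\rm old}}$ where $\mathbb A_{\rm old}$ is the active set before appending $j$, $\mathbf h=(h_{nj})_{n\in\mathbb A_{\rm old}}$, $h=h_{jj}$, and compute $y=H_{\rm old}^{-1}\mathbf h$, $q=h-\mathbf h^Ty$. If $q=0$: let $y_{\max}=\max(y)$, $f=\arg\max(y)$; if $y_{\max}\le0$, break (QP declared infeasible); otherwise remove the $f$-th entry from $\mathbb A$, $c\leftarrow c-1$, and update $H_{\mathbb A}^{-1},\lambda_{\mathbb A}$ first by SIMU (with the $f$-th entry removed) and then by AIMU (with $j$ appended). If $q\ne0$: update $H_{\mathbb A}^{-1},\lambda_{\mathbb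 A}$ by AIMU with $j$ appended. c. $\lambda_{\min}=\min(\lambda_{\mathbb A})$, $i=\arg\min(\lambda_{\mathbb A})$. d. While $\lambda_{\min}<0$: $m\leftarrow m+1$, $c\leftarrow c-1$, remove the $i$-th entry from $\mathbb A$, update $H_{\mathbb A}^{-1},\lambda_{\mathbb A}$ by SIMU, and recompute $\lambda_{\min}=\min(\lambda_{\mathbb A})$, $i=\arg\min(\lambda_{\mathbb A})$. e. $K=K_0+H_{\mathbb A,\rm col}\lambda_{\mathbb A}$. f. $K_{\min}=\min(K)$, $j=\arg\min(K)$. 5. $\theta^*=\theta_0-E^{-1}M_{\mathbb A}^T\lambda_{\mathbb A}$. $\mathbb A^m_{\rm old}$ and $\mathbb A^m_{\rm new}$ denote the active set before and after the addition or removal performed at iteration $m$; $\mathbb A^{m+1}_{\rm old}=\mathbb A^m_{\rm new}$, and $\mathbb A^1_{\rm new}=\varnothing$. *)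

theory Defs
  imports Complex_Main
    "Jordan_Normal_Form.Matrix"
    "Jordan_Normal_Form.Gauss_Jordan_Elimination"
    "Jordan_Normal_Form.DL_Rank"
begin

text \<open>Constraint indices and positions in lists and vectors are counted from 0, so that
  the constraints are numbered by \<open>{0..<p}\<close> and entry \<open>i\<close> of an active set \<open>A\<close> is \<open>A ! i\<close>.\<close>

definition pos_def_mat :: "real mat \<Rightarrow> bool" where
  "pos_def_mat E \<longleftrightarrow> E\<^sup>T = E \<and>
     (\<forall>x \<in> carrier_vec (dim_row E). x \<noteq> 0\<^sub>v (dim_row E) \<longrightarrow> x \<bullet> (E *\<^sub>v x) > 0)"

definition full_row_rank :: "real mat \<Rightarrow> bool" where
  "full_row_rank A \<longleftrightarrow> vec_space.rank (dim_row A) A = dim_row A"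

text \<open>Only used for matrices that are invertible.\<close>

definition mat_inv :: "real mat \<Rightarrow> real mat" where
  "mat_inv A = the (mat_inverse A)"

definition vec_min :: "real vec \<Rightarrow> real" where
  "vec_min v = Min (vec_set v)"

definition vec_max :: "real vec \<Rightarrow> real" where
  "vec_max v = Max (vec_set v)"

text \<open>An index attaining the extremum; ties may be broken arbitrarily.\<close>

definition argmin_vec :: "real vec \<Rightarrow> nat \<Rightarrow> bool" where
  "argmin_vec v i \<longleftrightarrow> is_arg_min (\<lambda>k. v $ k) (\<lambda>k. k < dim_vec v) i"

definition argmax_vec :: "real vec \<Rightarrow> nat \<Rightarrow> bool" where
  "argmax_vec v i \<longleftrightarrow> is_arg_max (\<lambda>k. v $ k) (\<lambda>k. k < dim_vec v) i"

definition delete_nth :: "nat \<Rightarrow> 'a list \<Rightarrow> 'a list" where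
  "delete_nth i xs = take i xs @ drop (Suc i) xs"

definition \<theta>0 :: "real mat \<Rightarrow> real vec \<Rightarrow> real vec" where
  "\<theta>0 E F = - (mat_inv E *\<^sub>v F)"

definition K0 :: "real mat \<Rightarrow> real vec \<Rightarrow> real mat \<Rightarrow> real vec \<Rightarrow> real vec" where
  "K0 E F M \<gamma> = \<gamma> - M *\<^sub>v \<theta>0 E F"

definition Hmat :: "real mat \<Rightarrow> real mat \<Rightarrow> real mat" where
  "Hmat E M = M * mat_inv E * M\<^sup>T"

definition M_sub :: "real mat \<Rightarrow> nat list \<Rightarrow> real mat" where
  "M_sub M A = mat_of_rows (dim_col M) (map (row M) A)"

definition H_sub :: "real mat \<Rightarrow> real mat \<Rightarrow> nat list \<Rightarrow> real mat" where
  "H_sub E M A = M_sub M A * mat_inv E * (M_sub M A)\<^sup>T"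

definition H_cols :: "real mat \<Rightarrow> real mat \<Rightarrow> nat list \<Rightarrow> real mat" where
  "H_cols E M A = mat_of_cols (dim_row M) (map (col (Hmat E M)) A)"

definition vec_sub :: "real vec \<Rightarrow> nat list \<Rightarrow> real vec" where
  "vec_sub v A = vec_of_list (map (\<lambda>n. v $ n) A)"

definition h_vec :: "real mat \<Rightarrow> real mat \<Rightarrow> nat list \<Rightarrow> nat \<Rightarrow> real vec" where
  "h_vec E M A j = vec_of_list (map (\<lambda>n. Hmat E M $$ (n, j)) A)"

text \<open>The common specification of the additive and subtractive inverse matrix updates:
  for the new active set \<open>A\<close> they produce the exact inverse of \<open>H_sub E M A\<close> and the
  corresponding multipliers.\<close>

definition inverse_update ::
  "real mat \<Rightarrow> real vec \<Rightarrow> real mat \<Rightarrow> real vec \<Rightarrow> nat list \<Rightarrow> real mat \<Rightarrow> real vec \<Rightarrow> bool" where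
  "inverse_update E F M \<gamma> A Hinv lam \<longleftrightarrow>
     mat_inverse (H_sub E M A) = Some Hinv \<and>
     lam = - (Hinv *\<^sub>v vec_sub (K0 E F M \<gamma>) A)"

text \<open>Only computed for a nonempty list \<open>A\<close>, the active set before appending \<open>j\<close>. The argument
  \<open>Hold\<close> is the stored inverse of \<open>H_sub E M A\<close>.\<close>

definition y_vec :: "real mat \<Rightarrow> real mat \<Rightarrow> nat list \<Rightarrow> real mat \<Rightarrow> nat \<Rightarrow> real vec" where
  "y_vec E M A Hold j = Hold *\<^sub>v h_vec E M A j"

definition q_val :: "real mat \<Rightarrow> real mat \<Rightarrow> nat list \<Rightarrow> real mat \<Rightarrow> nat \<Rightarrow> real" where
  "q_val E M A Hold j = Hmat E M $$ (j, j) - h_vec E M A j \<bullet> y_vec E M A Hold j"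

text \<open>Configurations of the imuQP algorithm, one constructor per control point:
  \<^item> \<open>Outer m A Hinv lam kmin j\<close>: the test of the outer loop;
  \<^item> \<open>Update m A Hinv lam kmin j\<close>: the choice of the update; here \<open>j\<close> is already the last entry
    of \<open>A\<close>, whereas \<open>Hinv\<close> and \<open>lam\<close> still belong to the list without it;
  \<^item> \<open>Inner m A Hinv lam\<close>: the test of the inner loop, which removes indices with negative multiplier;
  \<^item> \<open>Exit A lam\<close>: the outer loop has been left, the minimizer is still to be computed;
  \<^item> \<open>Infeasible\<close>: the quadratic program has been declared infeasible;
  \<^item> \<open>Return \<theta>\<close>: the algorithm has returned \<open>\<theta>\<close>.

  Here \<open>m\<close> is the iteration counter, \<open>A\<close> the active set (its length being the counter \<open>c\<close>),
  \<open>Hinv\<close> the inverse matrix, \<open>lam\<close> the multiplier vector and \<open>kmin\<close> the minimal slack.\<close>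

datatype imu_config =
    Outer nat "nat list" "real mat" "real vec" real nat
  | Update nat "nat list" "real mat" "real vec" real nat
  | Inner nat "nat list" "real mat" "real vec"
  | Exit "nat list" "real vec"
  | Infeasible
  | Return "real vec"

text \<open>The configurations occurring in some run of the algorithm. For the empty active set
  the inverse and the multipliers are of dimension 0; then \<open>inner_exit\<close> applies, since there is
  no negative multiplier. In \<open>update_first\<close> the quotient is meaningful only if row \<open>j\<close> of \<open>M\<close>
  is nonzero; otherwise it is 0 and \<open>M_sub M [j]\<close> does not have full row rank.\<close>

inductive imuQP :: "real mat \<Rightarrow> real vec \<Rightarrow> real mat \<Rightarrow> real vec \<Rightarrow> imu_config \<Rightarrow> bool"
  for E :: "real mat" and F :: "real vec" and M :: "real mat" and \<gamma> :: "real vec"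
where
  start_optimal:
    "\<lbrakk> argmin_vec (K0 E F M \<gamma>) j; vec_min (K0 E F M \<gamma>) \<ge> 0 \<rbrakk>
     \<Longrightarrow> imuQP E F M \<gamma> (Return (\<theta>0 E F))"
| start:
    "\<lbrakk> argmin_vec (K0 E F M \<gamma>) j; vec_min (K0 E F M \<gamma>) < 0 \<rbrakk>
     \<Longrightarrow> imuQP E F M \<gamma> (Outer 1 [] (1\<^sub>m 0) (0\<^sub>v 0) (vec_min (K0 E F M \<gamma>)) j)"
| outer_done:
    "\<lbrakk> imuQP E F M \<gamma> (Outer m A Hinv lam kmin j); kmin \<ge> 0 \<rbrakk>
     \<Longrightarrow> imuQP E F M \<gamma> (Exit A lam)"
| outer_break:
    "\<lbrakk> imuQP E F M \<gamma> (Outer m A Hinv lam kmin j); kmin < 0; j \<in> set A \<rbrakk>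
     \<Longrightarrow> imuQP E F M \<gamma> (Exit A lam)"
| append_index:
    "\<lbrakk> imuQP E F M \<gamma> (Outer m A Hinv lam kmin j); kmin < 0; j \<notin> set A \<rbrakk>
     \<Longrightarrow> imuQP E F M \<gamma> (Update (m + 1) (A @ [j]) Hinv lam kmin j)"
| update_first:
    "\<lbrakk> imuQP E F M \<gamma> (Update m [j] Hinv lam kmin j);
       Hinv' = mat 1 1 (\<lambda>_. 1 / (Hmat E M $$ (j, j)));
       lam' = - (Hinv' *\<^sub>v vec 1 (\<lambda>_. kmin)) \<rbrakk>
     \<Longrightarrow> imuQP E F M \<gamma> (Inner m [j] Hinv' lam')"
| update_infeasible:
    "\<lbrakk> imuQP E F M \<gamma> (Update m (A @ [j]) Hinv lam kmin j); A \<noteq> [];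
       y = y_vec E M A Hinv j; q_val E M A Hinv j = 0; vec_max y \<le> 0 \<rbrakk>
     \<Longrightarrow> imuQP E F M \<gamma> Infeasible"
| update_swap:
    "\<lbrakk> imuQP E F M \<gamma> (Update m (A @ [j]) Hinv lam kmin j); A \<noteq> [];
       y = y_vec E M A Hinv j; q_val E M A Hinv j = 0; vec_max y > 0; argmax_vec y f;
       inverse_update E F M \<gamma> (delete_nth f A) Hinv1 lam1;
       inverse_update E F M \<gamma> (delete_nth f A @ [j]) Hinv2 lam2 \<rbrakk>
     \<Longrightarrow> imuQP E F M \<gamma> (Inner m (delete_nth f A @ [j]) Hinv2 lam2)"
| update_add:
    "\<lbrakk> imuQP E F M \<gamma> (Update m (A @ [j]) Hinv lam kmin j); A \<noteq> [];
       q_val E M A Hinv j \<noteq> 0;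
       inverse_update E F M \<gamma> (A @ [j]) Hinv' lam' \<rbrakk>
     \<Longrightarrow> imuQP E F M \<gamma> (Inner m (A @ [j]) Hinv' lam')"
| inner_remove:
    "\<lbrakk> imuQP E F M \<gamma> (Inner m A Hinv lam); A \<noteq> [];
       argmin_vec lam i; vec_min lam < 0;
       inverse_update E F M \<gamma> (delete_nth i A) Hinv' lam' \<rbrakk>
     \<Longrightarrow> imuQP E F M \<gamma> (Inner (m + 1) (delete_nth i A) Hinv' lam')"
| inner_exit:
    "\<lbrakk> imuQP E F M \<gamma> (Inner m A Hinv lam); A = [] \<or> vec_min lam \<ge> 0;
       K = K0 E F M \<gamma> + H_cols E M A *\<^sub>v lam; argmin_vec K j \<rbrakk>
     \<Longrightarrow> imuQP E F M \<gamma> (Outer m A Hinv lam (vec_min K) j)"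
| finish:
    "imuQP E F M \<gamma> (Exit A lam)
     \<Longrightarrow> imuQP E F M \<gamma> (Return (\<theta>0 E F - mat_inv E *\<^sub>v ((M_sub M A)\<^sup>T *\<^sub>v lam)))"

end

theory Submission
  imports Defs
begin

text \<open>Write \<open>\<langle>u, v\<rangle> = u\<^sup>T E\<^sup>-\<^sup>1 v\<close>. The number \<open>q\<close> is the squared norm of \<open>m\<^sub>j - M\<^sub>A\<^sup>T y\<close> for this
  inner product, so \<open>q = 0\<close> gives \<open>m\<^sub>j = M\<^sub>A\<^sup>T y\<close>. The slack \<open>K\<^sub>j\<close>, negative when \<open>j\<close> is appended,
  then equals \<open>\<gamma>\<^sub>j - y \<bullet> \<gamma>\<^sub>A\<close>. As \<open>y \<le> 0\<close>, a feasible \<open>\<theta>\<close> satisfies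
  \<open>m\<^sub>j \<bullet> \<theta> = y \<bullet> M\<^sub>A \<theta> \<ge> y \<bullet> \<gamma>\<^sub>A > \<gamma>\<^sub>j\<close>, a contradiction.\<close>

section \<open>The inner product defined by the inverse of \<open>E\<close>\<close>

text \<open>A nonzero kernel vector of \<open>E\<close> would contradict definiteness, so
  \<open>det E\<close> is nonzero and Gauss-Jordan elimination succeeds; this gives the
  \<open>the\<close> in \<open>mat_inv\<close> a meaning.\<close>

lemma pos_def_mat_inv:
  assumes E: "E \<in> carrier_mat d d" and pd: "pos_def_mat E"
  shows "mat_inv E \<in> carrier_mat d d" and "E * mat_inv E = 1\<^sub>m d"
proof -
  have "det E \<noteq> 0"
  proof
    assume "det E = 0"
    then obtain v where "v \<in> carrier_vec d" "v \<noteq> 0\<^sub>v d" "E *\<^sub>v v = 0\<^sub>v d"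
      using det_0_iff_vec_prod_zero_field[OF E] by blast
    with pd E show False by (force simp: pos_def_mat_def)
  qed
  then have "E \<in> Units (ring_mat TYPE(real) d ())" by (rule det_non_zero_imp_unit[OF E])
  then have "mat_inverse E \<noteq> None" using mat_inverse(1)[OF E, of "()"] by argo
  then have "mat_inverse E = Some (mat_inv E)" by (auto simp: mat_inv_def)
  from mat_inverse(2)[OF E this] show "mat_inv E \<in> carrier_mat d d" "E * mat_inv E = 1\<^sub>m d"
    by auto
qed

text \<open>Both parts rest on \<open>form\<close>, where the symmetry of \<open>E\<close> lets it
  pass to the other factor. Cancelling \<open>E\<close> against its inverse gives the first part;
  for equal arguments definiteness of \<open>E\<close> forces \<open>?G *\<^sub>v x\<close> to
  vanish, and applying \<open>E\<close> gives the second.\<close>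

lemma
  assumes E: "E \<in> carrier_mat d d" and pd: "pos_def_mat E" and x: "x \<in> carrier_vec d"
  shows mat_inv_symmetric:
      "y \<in> carrier_vec d \<Longrightarrow> x \<bullet> (mat_inv E *\<^sub>v y) = y \<bullet> (mat_inv E *\<^sub>v x)"
    and mat_inv_definite: "x \<bullet> (mat_inv E *\<^sub>v x) = 0 \<Longrightarrow> x = 0\<^sub>v d"
proof -
  let ?G = "mat_inv E"
  note G = pos_def_mat_inv[OF E pd]
  have EG: "E *\<^sub>v (?G *\<^sub>v v) = v" if "v \<in> carrier_vec d" for v
    using assoc_mult_mat_vec[OF E G(1) that] G(2) that by simp
  have Gv: "?G *\<^sub>v v \<in> carrier_vec d" if "v \<in> carrier_vec d" for v
    using G(1) that by simp
  have sym: "E\<^sup>T = E" using pd by (simp add: pos_def_mat_def)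
  have form: "u \<bullet> (?G *\<^sub>v v) = (?G *\<^sub>v u) \<bullet> (E *\<^sub>v (?G *\<^sub>v v))"
    if "u \<in> carrier_vec d" "v \<in> carrier_vec d" for u v
    using transpose_vec_mult_scalar[OF E Gv[OF that(2)] Gv[OF that(1)]] EG that sym by simp
  show "x \<bullet> (?G *\<^sub>v y) = y \<bullet> (?G *\<^sub>v x)" if y: "y \<in> carrier_vec d"
    using form[OF x y] EG[OF y] comm_scalar_prod[OF y Gv[OF x]] by simp
  assume "x \<bullet> (?G *\<^sub>v x) = 0"
  then have "?G *\<^sub>v x = 0\<^sub>v d"
    using form[OF x x] pd E Gv[OF x] by (force simp: pos_def_mat_def)
  then show "x = 0\<^sub>v d" using EG[OF x] E by auto
qed

text \<open>\<open>Hmat\<close> and \<open>H_sub\<close> are both of this Gram form, so one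
  computation of entries serves both.\<close>

lemma congruence_index:
  fixes B :: "real mat"
  assumes "B \<in> carrier_mat n d" "G \<in> carrier_mat d d" "i < n" "k < n"
  shows "(B * G * B\<^sup>T) $$ (i, k) = row B i \<bullet> (G *\<^sub>v row B k)"
proof -
  have "B * G * B\<^sup>T = B * (G * B\<^sup>T)" using assms by (intro assoc_mult_mat) auto
  moreover have "col (G * B\<^sup>T) k = G *\<^sub>v row B k"
    using assms by (subst col_mult2[of _ d d _ n]) auto
  ultimately show ?thesis using assms by simp
qed

section \<open>Extrema and restriction to an active set\<close>

lemma argmin_vec_less: "argmin_vec v j \<Longrightarrow> j < dim_vec v"
  by (simp add: argmin_vec_def is_arg_min_def)

text \<open>Ties the minimal slack stored in a configuration to the index stored with it, however
  ties are broken.\<close>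

lemma vec_min_argmin:
  assumes "argmin_vec v j"
  shows "vec_min v = v $ j"
proof -
  have "v $ j \<le> v $ k" if "k < dim_vec v" for k
    using assms that by (auto simp: argmin_vec_def is_arg_min_linorder)
  moreover have "j < dim_vec v" by (rule argmin_vec_less[OF assms])
  ultimately show ?thesis
    unfolding vec_min_def by (intro Min_eqI) (auto simp: vec_set_def)
qed

lemma set_delete_nth: "set (delete_nth i xs) \<subseteq> set xs"
  by (auto simp: delete_nth_def dest: in_set_takeD in_set_dropD)

lemma M_sub_carrier [simp]: "M_sub M A \<in> carrier_mat (length A) (dim_col M)"
  using mat_of_rows_carrier(1)[of "dim_col M" "map (row M) A"] by (simp add: M_sub_def)

lemma dim_row_M_sub [simp]: "dim_row (M_sub M A) = length A"
  by (simp add: M_sub_def)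

lemma row_M_sub: "i < length A \<Longrightarrow> row (M_sub M A) i = row M (A ! i)"
  by (simp add: M_sub_def)

lemma H_sub_carrier [simp]: "H_sub E M A \<in> carrier_mat (length A) (length A)"
  by (rule carrier_matI) (simp_all add: H_sub_def M_sub_def)

lemma dim_vec_sub [simp]: "dim_vec (vec_sub v A) = length A"
  by (simp add: vec_sub_def)

lemma vec_sub_index: "i < length A \<Longrightarrow> vec_sub v A $ i = v $ (A ! i)"
  by (simp add: vec_sub_def vec_of_list_index)

section \<open>An invariant of all runs\<close>

text \<open>Asks for a right inverse instead of a result of \<open>mat_inverse\<close>, so that the
  first update, which writes down a 1 by 1 inverse explicitly, is covered too.\<close>

definition exact_multipliers ::
  "real mat \<Rightarrow> real vec \<Rightarrow> real mat \<Rightarrow> real vec \<Rightarrow> nat list \<Rightarrow> real mat \<Rightarrow> real vec \<Rightarrow> bool" where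
  "exact_multipliers E F M \<gamma> A Hinv lam \<longleftrightarrow>
     Hinv \<in> carrier_mat (length A) (length A) \<and> H_sub E M A * Hinv = 1\<^sub>m (length A) \<and>
     lam = - (Hinv *\<^sub>v vec_sub (K0 E F M \<gamma>) A)"

lemma inverse_update_exact:
  assumes "inverse_update E F M \<gamma> A Hinv lam"
  shows "exact_multipliers E F M \<gamma> A Hinv lam"
proof -
  have "mat_inverse (H_sub E M A) = Some Hinv" using assms by (simp add: inverse_update_def)
  from mat_inverse(2)[OF H_sub_carrier this] show ?thesis
    using assms by (simp add: inverse_update_def exact_multipliers_def)
qed

text \<open>The exception for a singleton \<open>[j]\<close> covers a zero row \<open>j\<close>, for which the first update divides by 0.\<close>

definition active_inv ::
  "real mat \<Rightarrow> real vec \<Rightarrow> real mat \<Rightarrow> real vec \<Rightarrow> nat list \<Rightarrow> real mat \<Rightarrow> real vec \<Rightarrow> bool" where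
  "active_inv E F M \<gamma> A Hinv lam \<longleftrightarrow>
     set A \<subseteq> {..<dim_row M} \<and> dim_vec lam = length A \<and>
     (A = [] \<or> (\<exists>j. A = [j] \<and> Hmat E M $$ (j, j) = 0) \<or> exact_multipliers E F M \<gamma> A Hinv lam)"

abbreviation slack ::
  "real mat \<Rightarrow> real vec \<Rightarrow> real mat \<Rightarrow> real vec \<Rightarrow> nat list \<Rightarrow> real vec \<Rightarrow> real vec" where
  "slack E F M \<gamma> A lam \<equiv> K0 E F M \<gamma> + H_cols E M A *\<^sub>v lam"

text \<open>In \<open>Update\<close> the data \<open>Hinv\<close> and \<open>lam\<close> belong to
  the list before \<open>j\<close> was appended, hence the splitting of \<open>B\<close>. The clause
  \<open>kmin < 0\<close>, inherited from the loop test, feeds the final contradiction.\<close>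

fun config_inv ::
  "real mat \<Rightarrow> real vec \<Rightarrow> real mat \<Rightarrow> real vec \<Rightarrow> imu_config \<Rightarrow> bool" where
  "config_inv E F M \<gamma> (Outer m A Hinv lam kmin j) \<longleftrightarrow>
     active_inv E F M \<gamma> A Hinv lam \<and> j < dim_row M \<and> kmin = slack E F M \<gamma> A lam $ j"
| "config_inv E F M \<gamma> (Update m B Hinv lam kmin j) \<longleftrightarrow>
     (\<exists>A. B = A @ [j] \<and> active_inv E F M \<gamma> A Hinv lam \<and> j < dim_row M \<and>
       kmin = slack E F M \<gamma> A lam $ j \<and> kmin < 0)"
| "config_inv E F M \<gamma> (Inner m A Hinv lam) \<longleftrightarrow> active_inv E F M \<gamma> A Hinv lam"
| "config_inv E F M \<gamma> _ \<longleftrightarrow> True"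

lemma inverse_update_active_inv:
  assumes "inverse_update E F M \<gamma> A Hinv lam" and "set A \<subseteq> {..<dim_row M}"
  shows "active_inv E F M \<gamma> A Hinv lam"
  using inverse_update_exact[OF assms(1)] assms(2)
  by (auto simp: active_inv_def exact_multipliers_def)

text \<open>A matrix without columns contributes an empty sum, so the start and the first update fit
  the general formula for the slack.\<close>

lemma slack_Nil:
  assumes "dim_vec lam = 0"
  shows "slack E F M \<gamma> [] lam = K0 E F M \<gamma>"
  using assms by (intro eq_vecI) (auto simp: H_cols_def K0_def scalar_prod_def)

text \<open>Every update but the first is exact by \<open>inverse_update\<close>; the first is
  checked by hand. Each \<open>kmin\<close> is the minimum of a slack vector, attained at
  \<open>j\<close>.\<close>

lemma imuQP_config_inv:
  assumes "E \<in> carrier_mat d d" and "pos_def_mat E"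
    and "M \<in> carrier_mat p d" and "\<gamma> \<in> carrier_vec p"
    and "imuQP E F M \<gamma> s"
  shows "config_inv E F M \<gamma> s"
  using assms(5)
proof (induction rule: imuQP.induct)
  case (start j)
  have "j < dim_row M"
    using argmin_vec_less[OF start(1)] assms by (simp add: K0_def)
  moreover have "slack E F M \<gamma> [] (0\<^sub>v 0) = K0 E F M \<gamma>"
    by (rule slack_Nil) simp
  ultimately show ?case
    using vec_min_argmin[OF start(1)] by (simp add: active_inv_def)
next
  case (update_first m j Hinv lam kmin Hinv' lam')
  from update_first.IH have j: "j < dim_row M" and lam: "dim_vec lam = 0"
    and kmin: "kmin = slack E F M \<gamma> [] lam $ j"
    by (auto simp: active_inv_def)
  from kmin have kmin: "kmin = K0 E F M \<gamma> $ j"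
    using slack_Nil[OF lam] by simp
  have K: "vec_sub (K0 E F M \<gamma>) [j] = vec 1 (\<lambda>_. kmin)"
    by (intro eq_vecI) (auto simp: vec_sub_index kmin)
  \<comment> \<open>If the diagonal entry is 0, the exception for singletons in
    \<open>active_inv\<close> applies instead.\<close>
  have "exact_multipliers E F M \<gamma> [j] Hinv' lam'" if "Hmat E M $$ (j, j) \<noteq> 0"
  proof -
    note G = pos_def_mat_inv(1)[OF assms(1,2)]
    have M: "M_sub M [j] \<in> carrier_mat 1 d"
      using M_sub_carrier[of M "[j]"] assms by simp
    have "H_sub E M [j] $$ (0, 0) = Hmat E M $$ (j, j)"
      using congruence_index[OF M G, of 0 0] congruence_index[OF assms(3) G, of j j] j assms
      by (simp add: H_sub_def Hmat_def row_M_sub)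
    then have "H_sub E M [j] * Hinv' = 1\<^sub>m 1"
      using that H_sub_carrier[of E M "[j]"]
      by (intro eq_matI) (auto simp: update_first.hyps scalar_prod_def)
    then show ?thesis
      using K update_first.hyps by (simp add: exact_multipliers_def)
  qed
  then show ?case
    using j update_first.hyps by (auto simp: active_inv_def)
next
  case (update_swap m A j Hinv lam kmin y f Hinv1 lam1 Hinv2 lam2)
  then have "set (delete_nth f A @ [j]) \<subseteq> {..<dim_row M}"
    using set_delete_nth[of f A] by (auto simp: active_inv_def)
  then show ?case
    using inverse_update_active_inv[OF update_swap.hyps(8)] by simp
next
  case (update_add m A j Hinv lam kmin Hinv' lam')
  then have "set (A @ [j]) \<subseteq> {..<dim_row M}" by (auto simp: active_inv_def)
  then show ?case
    using inverse_update_active_inv[OF update_add.hyps(4)] by simp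
next
  case (inner_remove m A Hinv lam i Hinv' lam')
  then have "set (delete_nth i A) \<subseteq> {..<dim_row M}"
    using set_delete_nth[of i A] by (auto simp: active_inv_def)
  then show ?case
    using inverse_update_active_inv[OF inner_remove.hyps(5)] by simp
next
  case (inner_exit m A Hinv lam K j)
  have "dim_vec K = dim_row M" using inner_exit by (simp add: H_cols_def)
  then show ?case
    using inner_exit argmin_vec_less[of K j] vec_min_argmin[of K j] by simp
qed auto

section \<open>Entries of \<open>Hmat\<close> as inner products of rows\<close>

text \<open>The diagonal entry is the squared norm of row \<open>j\<close>; if it vanished, the row
  would be zero and the rank 0 instead of 1. This excludes the degenerate singleton of
  \<open>active_inv\<close>.\<close>

lemma full_row_rank_singleton:
  assumes E: "E \<in> carrier_mat d d" "pos_def_mat E" and M: "M \<in> carrier_mat p d"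
    and j: "j < p" and rank: "full_row_rank (M_sub M [j])"
  shows "Hmat E M $$ (j, j) \<noteq> 0"
proof
  assume "Hmat E M $$ (j, j) = 0"
  then have "row M j \<bullet> (mat_inv E *\<^sub>v row M j) = 0"
    using congruence_index[OF M pos_def_mat_inv(1)[OF E], of j j] j M by (simp add: Hmat_def)
  then have "row M j = 0\<^sub>v d"
    using mat_inv_definite[OF E, of "row M j"] M j by auto
  then have "M_sub M [j] = 0\<^sub>m 1 d"
    using M by (intro eq_matI) (auto simp: M_sub_def mat_of_rows_index)
  then show False
    using rank vec_space.rank_0I[where 'a = real, of 1 d] by (simp add: full_row_rank_def)
qed

lemma Hmat_index:
  assumes "E \<in> carrier_mat d d" "pos_def_mat E" "M \<in> carrier_mat p d" "i < p" "k < p"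
  shows "Hmat E M $$ (i, k) = row M i \<bullet> (mat_inv E *\<^sub>v row M k)"
  using congruence_index[OF assms(3) pos_def_mat_inv(1)[OF assms(1,2)] assms(4,5)]
  by (simp add: Hmat_def)

text \<open>Brings \<open>h_vec\<close> into a form in which \<open>M_sub M A\<close> can be moved
  across scalar products as its transpose.\<close>

lemma h_vec_eq:
  assumes E: "E \<in> carrier_mat d d" "pos_def_mat E" and M: "M \<in> carrier_mat p d"
    and A: "set A \<subseteq> {..<p}" and j: "j < p"
  shows "h_vec E M A j = M_sub M A *\<^sub>v (mat_inv E *\<^sub>v row M j)"
proof (rule eq_vecI)
  fix i assume "i < dim_vec (M_sub M A *\<^sub>v (mat_inv E *\<^sub>v row M j))"
  then have i: "i < length A" by (simp add: M_sub_def)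
  then have "A ! i < p" using A nth_mem by blast
  then show "h_vec E M A j $ i = (M_sub M A *\<^sub>v (mat_inv E *\<^sub>v row M j)) $ i"
    using i j Hmat_index[OF E M, of "A ! i" j]
    by (simp add: h_vec_def vec_of_list_index row_M_sub)
qed (simp add: h_vec_def M_sub_def)

text \<open>\<open>H_cols\<close> supplies the entries \<open>(j, n)\<close>, \<open>h_vec\<close>
  the entries \<open>(n, j)\<close>; they agree because the form given by \<open>mat_inv E\<close>
  is symmetric.\<close>

lemma row_H_cols:
  assumes E: "E \<in> carrier_mat d d" "pos_def_mat E" and M: "M \<in> carrier_mat p d"
    and A: "set A \<subseteq> {..<p}" and j: "j < p"
  shows "row (H_cols E M A) j = h_vec E M A j"
proof (rule eq_vecI)
  fix i assume "i < dim_vec (h_vec E M A j)"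
  then have i: "i < length A" by (simp add: h_vec_def)
  then have Ai: "A ! i < p" using A nth_mem by blast
  then have "Hmat E M $$ (j, A ! i) = Hmat E M $$ (A ! i, j)"
    using Hmat_index[OF E M] mat_inv_symmetric[OF E, of "row M j" "row M (A ! i)"] j M by simp
  then show "row (H_cols E M A) j $ i = h_vec E M A j $ i"
    using i j M Ai
    by (simp add: H_cols_def h_vec_def vec_of_list_index mat_of_cols_index Hmat_def)
qed (simp add: h_vec_def H_cols_def)

theorem theorem4:
  fixes d p m j :: nat
    and E M Hold :: "real mat"
    and F \<gamma> lam y :: "real vec"
    and A_old :: "nat list"
    and kmin q :: real
  assumes "E \<in> carrier_mat d d" and "pos_def_mat E"
    and "F \<in> carrier_vec d"
    and "M \<in> carrier_mat p d" and "\<gamma> \<in> carrier_vec p"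
    and "imuQP E F M \<gamma> (Update m (A_old @ [j]) Hold lam kmin j)"
    and "A_old \<noteq> []"
    and "full_row_rank (M_sub M A_old)"
    and "y = y_vec E M A_old Hold j"
    and "q = q_val E M A_old Hold j"
    and "q = 0"
    and "vec_max y \<le> 0"
  shows "{\<theta> \<in> carrier_vec d. M *\<^sub>v \<theta> \<le> \<gamma>} = {}"
proof -
  let ?A = A_old and ?G = "mat_inv E" and ?MA = "M_sub M A_old" and ?mj = "row M j"
  let ?c = "length A_old" and ?h = "h_vec E M A_old j" and ?\<gamma>A = "vec_sub \<gamma> A_old"
  let ?K = "vec_sub (K0 E F M \<gamma>) A_old" and ?H = "H_sub E M A_old"
  note E = assms(1,2) and M = assms(4) and \<gamma> = assms(5)
  note G = pos_def_mat_inv(1)[OF E]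
  from imuQP_config_inv[OF E M \<gamma> assms(6)]
  have inv: "active_inv E F M \<gamma> ?A Hold lam" and j: "j < p"
    and neg: "slack E F M \<gamma> ?A lam $ j < 0"
    using M by auto
  have A: "set ?A \<subseteq> {..<p}" using inv M by (auto simp: active_inv_def)
  have Ai: "?A ! i < p" if "i < ?c" for i using A that nth_mem by blast
  \<comment> \<open>The empty list is excluded by assumption, the degenerate singleton by full row
    rank.\<close>
  have "exact_multipliers E F M \<gamma> ?A Hold lam"
    using inv assms(7,8) full_row_rank_singleton[OF E M] M by (auto simp: active_inv_def)
  then have Hold: "Hold \<in> carrier_mat ?c ?c" and HHold: "?H * Hold = 1\<^sub>m ?c"
    and lam: "lam = - (Hold *\<^sub>v ?K)"
    by (auto simp: exact_multipliers_def)

  have mj: "?mj \<in> carrier_vec d" using M j by auto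
  have MA: "?MA \<in> carrier_mat ?c d" using M M_sub_carrier[of M ?A] by simp
  have h: "?h \<in> carrier_vec ?c" by (intro carrier_vecI) (simp add: h_vec_def)
  have K: "?K \<in> carrier_vec ?c" by (intro carrier_vecI) simp
  have \<gamma>A: "?\<gamma>A \<in> carrier_vec ?c" by (intro carrier_vecI) simp
  have y: "y \<in> carrier_vec ?c" using Hold h assms(9) by (simp add: y_vec_def)
  have lamc: "lam \<in> carrier_vec ?c" using Hold K lam by simp
  have MTy: "?MA\<^sup>T *\<^sub>v y \<in> carrier_vec d" using MA y by simp
  have h_eq: "?h = ?MA *\<^sub>v (?G *\<^sub>v ?mj)" by (rule h_vec_eq[OF E M A j])
  have H_apply: "?H *\<^sub>v v = ?MA *\<^sub>v (?G *\<^sub>v (?MA\<^sup>T *\<^sub>v v))" if "v \<in> carrier_vec ?c" for v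
  proof -
    have "?H *\<^sub>v v = (?MA * ?G) *\<^sub>v (?MA\<^sup>T *\<^sub>v v)"
      unfolding H_sub_def using MA G that by (intro assoc_mult_mat_vec) auto
    also have "\<dots> = ?MA *\<^sub>v (?G *\<^sub>v (?MA\<^sup>T *\<^sub>v v))"
      using MA G that by (intro assoc_mult_mat_vec) auto
    finally show ?thesis .
  qed
  have HHold_apply: "?H *\<^sub>v (Hold *\<^sub>v v) = v" if "v \<in> carrier_vec ?c" for v
    using assoc_mult_mat_vec[OF H_sub_carrier[of E M ?A] Hold that] HHold that by simp
  \<comment> \<open>These are the normal equations for approximating row \<open>j\<close> by the
    active rows; \<open>z\<close> below is the residual.\<close>
  have Hy: "?H *\<^sub>v y = ?h" using HHold_apply[OF h] assms(9) by (simp add: y_vec_def)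
  have move: "(?MA\<^sup>T *\<^sub>v y) \<bullet> v = y \<bullet> (?MA *\<^sub>v v)" if "v \<in> carrier_vec d" for v
    by (rule transpose_vec_mult_scalar[OF MA that y])

  define z where "z = ?mj - ?MA\<^sup>T *\<^sub>v y"
  have z: "z \<in> carrier_vec d" using mj MTy by (simp add: z_def)
  have Gmj: "?G *\<^sub>v ?mj \<in> carrier_vec d" and GMTy: "?G *\<^sub>v (?MA\<^sup>T *\<^sub>v y) \<in> carrier_vec d"
    using G mj MTy by auto
  \<comment> \<open>Expanding the squared norm of \<open>z\<close> bilinearly gives four terms, each
    equal to \<open>y \<bullet> ?h\<close>, so they cancel.\<close>
  have "?mj \<bullet> (?G *\<^sub>v (?MA\<^sup>T *\<^sub>v y)) = y \<bullet> ?h"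
    using mat_inv_symmetric[OF E mj MTy] move[OF Gmj] h_eq by simp
  moreover have "(?MA\<^sup>T *\<^sub>v y) \<bullet> (?G *\<^sub>v ?mj) = y \<bullet> ?h"
    using move[OF Gmj] h_eq by simp
  moreover have "(?MA\<^sup>T *\<^sub>v y) \<bullet> (?G *\<^sub>v (?MA\<^sup>T *\<^sub>v y)) = y \<bullet> ?h"
    using move[OF GMTy] H_apply[OF y] Hy by simp
  \<comment> \<open>This is the term that relies on \<open>q = 0\<close>.\<close>
  moreover have "?mj \<bullet> (?G *\<^sub>v ?mj) = y \<bullet> ?h"
    using assms(9-11) Hmat_index[OF E M j j] comm_scalar_prod[OF h y] by (simp add: q_val_def)
  moreover have "?G *\<^sub>v z = ?G *\<^sub>v ?mj - ?G *\<^sub>v (?MA\<^sup>T *\<^sub>v y)"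
    unfolding z_def by (rule mult_minus_distrib_mat_vec[OF G mj MTy])
  moreover have "z \<bullet> (u - v) = ?mj \<bullet> u - ?mj \<bullet> v - ((?MA\<^sup>T *\<^sub>v y) \<bullet> u - (?MA\<^sup>T *\<^sub>v y) \<bullet> v)"
    if "u \<in> carrier_vec d" "v \<in> carrier_vec d" for u v
    using that mj MTy unfolding z_def
    by (simp add: minus_scalar_prod_distrib[of _ d] scalar_prod_minus_distrib[of _ d])
  ultimately have "z \<bullet> (?G *\<^sub>v z) = 0" using Gmj GMTy by simp
  then have z0: "z = 0\<^sub>v d" by (rule mat_inv_definite[OF E z])
  have mj_eq: "?mj = ?MA\<^sup>T *\<^sub>v y"
  proof (rule eq_vecI)
    fix i assume i: "i < dim_vec (?MA\<^sup>T *\<^sub>v y)"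
    then have "i < d" using carrier_vecD[OF MTy] by simp
    then have "z $ i = 0" by (simp add: z0)
    then show "?mj $ i = (?MA\<^sup>T *\<^sub>v y) $ i"
      unfolding z_def index_minus_vec(1)[OF i] by simp
  qed (simp only: carrier_vecD[OF mj] carrier_vecD[OF MTy])
  \<comment> \<open>Applied below to three vectors: one built from \<open>lam\<close>, the
    unconstrained minimizer, and a feasible point.\<close>
  have mj_dot: "?mj \<bullet> v = y \<bullet> (?MA *\<^sub>v v)" if "v \<in> carrier_vec d" for v
    using move[OF that] mj_eq by simp

  have \<theta>0: "\<theta>0 E F \<in> carrier_vec d" using G assms(3) by (simp add: \<theta>0_def)
  have K_eq: "?K = ?\<gamma>A - ?MA *\<^sub>v \<theta>0 E F"
    using M MA \<gamma> Ai by (intro eq_vecI) (auto simp: vec_sub_index K0_def row_M_sub)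
  have K0j: "K0 E F M \<gamma> $ j = \<gamma> $ j - ?mj \<bullet> \<theta>0 E F"
    using M j by (simp add: K0_def)
  \<comment> \<open>As row \<open>j\<close> is the combination \<open>y\<close> of active rows, the
    left side becomes \<open>y \<bullet> (?H *\<^sub>v lam)\<close>, and exact multipliers turn
    \<open>?H *\<^sub>v lam\<close> into \<open>- ?K\<close>.\<close>
  have "?h \<bullet> lam = - (y \<bullet> ?K)"
  proof -
    have MTl: "?MA\<^sup>T *\<^sub>v lam \<in> carrier_vec d" using MA lamc by simp
    have "?h \<bullet> lam = (?MA\<^sup>T *\<^sub>v lam) \<bullet> (?G *\<^sub>v ?mj)"
      using transpose_vec_mult_scalar[OF MA Gmj lamc] comm_scalar_prod[OF h lamc] h_eq by simp
    also have "\<dots> = ?mj \<bullet> (?G *\<^sub>v (?MA\<^sup>T *\<^sub>v lam))" by (rule mat_inv_symmetric[OF E MTl mj])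
    also have "\<dots> = y \<bullet> (?H *\<^sub>v lam)" using mj_dot G MTl H_apply[OF lamc] by simp
    also have "?H *\<^sub>v lam = - (?H *\<^sub>v (Hold *\<^sub>v ?K))"
      unfolding lam using carrier_matD[OF H_sub_carrier[of E M ?A]] carrier_matD[OF Hold]
      by (intro eq_vecI) simp_all
    also have "\<dots> = - ?K" using HHold_apply[OF K] by simp
    also have "y \<bullet> (- ?K) = - (y \<bullet> ?K)" using y by simp
    finally show ?thesis .
  qed
  moreover have "slack E F M \<gamma> ?A lam $ j = K0 E F M \<gamma> $ j + ?h \<bullet> lam"
    using row_H_cols[OF E M A j] j M by (simp add: H_cols_def)
  moreover have "y \<bullet> ?K = y \<bullet> ?\<gamma>A - ?mj \<bullet> \<theta>0 E F"
    unfolding K_eq using mj_dot[OF \<theta>0] y \<gamma>A MA \<theta>0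
    by (simp add: scalar_prod_minus_distrib[of _ ?c])
  \<comment> \<open>The two occurrences of \<open>?mj \<bullet> \<theta>0 E F\<close>
    cancel.\<close>
  ultimately have gap: "\<gamma> $ j < y \<bullet> ?\<gamma>A" using neg K0j by simp

  have y_nonpos: "y $ i \<le> 0" if "i < ?c" for i
  proof -
    have "y $ i \<le> vec_max y"
      unfolding vec_max_def using that y by (intro Max_ge) (auto simp: vec_set_def)
    then show ?thesis using assms(12) by simp
  qed
  have False if \<theta>: "\<theta> \<in> carrier_vec d" and feas: "M *\<^sub>v \<theta> \<le> \<gamma>" for \<theta>
  proof -
    have row_le: "row M i \<bullet> \<theta> \<le> \<gamma> $ i" if "i < p" for i
      using feas that M \<gamma> by (auto simp: less_eq_vec_def)
    \<comment> \<open>The nonpositive weights in \<open>y\<close> reverse the inequalities of the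
      active rows.\<close>
    have "y \<bullet> ?\<gamma>A \<le> y \<bullet> (?MA *\<^sub>v \<theta>)"
      unfolding scalar_prod_def using y_nonpos row_le Ai MA
      by (auto simp: vec_sub_index row_M_sub intro!: sum_mono mult_left_mono_neg)
    then show False using mj_dot[OF \<theta>] row_le[OF j] gap by simp
  qed
  then show ?thesis by blast
qed

end
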